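(* Let $\beta^0\in\mathbb{R}^p$, let $f$ be a penalty of max-linear form (see context) with pattern function $I$, and let $(\hat\beta_n^{(1)})$ be a sequence of estimators such that $\sqrt n(\hat\beta_n^{(1)}-\beta^0)$ converges in distribution to $W$ for some random vector $W$ with sub-gaussian entries. Then for $\hat\beta_n^{(2)}=\operatorname{Prox}_{n^{-1/2}\alpha f}(\hat\beta_n^{(1)})$, for all $\alpha\ge0$, $$\lim_{n\to\infty}\mathbb P\big[I(\hat\beta_n^{(2)})=I(\beta^0)\big]\ge1-2e^{-c\alpha^2},$$ for some $c>0$, provided the pattern space $\langle U_{\beta^0}\rangle$ intersects the relative interior of $\partial f(\beta^0)$.
   Context: Max-linear form: a penalty $f:\mathbb{R}^p\to\mathbb{R}$ is of max-linear form if $f(x)=\max\{\langle v_i,x\rangle:i\in\mathcal S\}+g(x)$, where $\mathcal S$ is a finite index set, $g:\mathbb{R}^p\to\mathbb{R}$ is convex and continuously differentiable, and $v_i$ ($i\in\mathcal S$) are distinct vectors in $\mathbb{R}^p$ such that $v_i$ is not in the convex hull of $\{v_j:j\neq i\}$ for every $i\in\mathcal S$. Pattern: $I(x)=\operatorname{argmax}_{i\in\mathcal S}\langle v_i,x\rangle\subset\mathcal S$. Pattern space of $f$ at $x$: $\langle U_x\rangle=\operatorname{span}\{u\in\mathbb{R}^p:I(u)=I(x)\}$. Proximal operator of a convex $h:\mathbb{R}^p\to\mathbb{R}$: $\operatorname{Prox}_h(\beta)=\operatorname{argmin}_{\xi\in\mathbb{R}^p}\frac12\Vert\beta-\xi\Vert_2^2+h(\xi)$.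 $\partial f$ is the convex subdifferential; the relative interior is taken with respect to the affine hull.
   Formalization: The limit of the probabilities is replaced by the limit inferior, because the limit need not exist (p=1, f=|x|, β⁰=0, √n β̂ₙ⁽¹⁾=1+(−1)ⁿ/n, W=1, α=1: the probability alternates between 0 and 1); when the limit exists, the stated bound follows. *)

theory Defs
  imports "HOL-Probability.Probability"
begin

section \<open>Penalties of max-linear form and their patterns\<close>

definition max_linear_form ::
  "'i set \<Rightarrow> ('i \<Rightarrow> real ^ 'p) \<Rightarrow> (real ^ 'p \<Rightarrow> real) \<Rightarrow> (real ^ 'p \<Rightarrow> real) \<Rightarrow> bool" where
  "max_linear_form S v g f \<longleftrightarrow>
     finite S \<and> S \<noteq> {} \<and>
     inj_on v S \<and> (\<forall>i\<in>S. v i \<notin> convex hull (v ` (S - {i}))) \<and>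
     convex_on UNIV g \<and>
     (\<exists>g'. (\<forall>x. GDERIV g x :> g' x) \<and> continuous_on UNIV g') \<and>
     (\<forall>x. f x = Max ((\<lambda>i. v i \<bullet> x) ` S) + g x)"

definition pattern :: "'i set \<Rightarrow> ('i \<Rightarrow> real ^ 'p) \<Rightarrow> real ^ 'p \<Rightarrow> 'i set" where
  "pattern S v x = {i. is_arg_max (\<lambda>i. v i \<bullet> x) (\<lambda>i. i \<in> S) i}"

definition pattern_space :: "'i set \<Rightarrow> ('i \<Rightarrow> real ^ 'p) \<Rightarrow> real ^ 'p \<Rightarrow> (real ^ 'p) set" where
  "pattern_space S v x = span {u. pattern S v u = pattern S v x}"

section \<open>Convex analysis\<close>

definition subdifferential :: "('a::real_inner \<Rightarrow> real) \<Rightarrow> 'a \<Rightarrow> 'a set" where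
  "subdifferential f x = {s. \<forall>y. f y \<ge> f x + s \<bullet> (y - x)}"

text \<open>For convex real-valued \<open>h\<close> on a Euclidean space the objective below is continuous, strongly
  convex and coercive, so its minimiser exists and is unique and the choice made by
  \<open>arg_min\<close> is immaterial.\<close>

definition prox :: "('a::real_inner \<Rightarrow> real) \<Rightarrow> 'a \<Rightarrow> 'a" where
  "prox h \<beta> = arg_min (\<lambda>\<xi>. 1/2 * (norm (\<beta> - \<xi>))\<^sup>2 + h \<xi>) (\<lambda>_. True)"

section \<open>Probability\<close>

text \<open>The limit \<open>Y\<close> may live on a probability space \<open>N\<close> different from that of the sequence \<open>X\<close>.
  The library notion \<open>weak_conv_m\<close> covers real-valued variables only.\<close>

definition converges_in_distribution ::
  "'a measure \<Rightarrow> (nat \<Rightarrow> 'a \<Rightarrow> 'e::euclidean_space) \<Rightarrow> 'b measure \<Rightarrow> ('b \<Rightarrow> 'e) \<Rightarrow> bool" where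
  "converges_in_distribution M X N Y \<longleftrightarrow>
     (\<forall>\<phi>::'e \<Rightarrow> real. continuous_on UNIV \<phi> \<longrightarrow> bounded (range \<phi>) \<longrightarrow>
        (\<lambda>n. \<integral>\<omega>. \<phi> (X n \<omega>) \<partial>M) \<longlonglongrightarrow> (\<integral>\<omega>. \<phi> (Y \<omega>) \<partial>N))"

text \<open>Tail definition of a sub-gaussian variable, which does not require the variable to be
  centred.\<close>

definition sub_gaussian :: "'b measure \<Rightarrow> ('b \<Rightarrow> real) \<Rightarrow> bool" where
  "sub_gaussian N X \<longleftrightarrow>
     X \<in> borel_measurable N \<and>
     (\<exists>K>0. \<forall>t\<ge>0. measure N {\<omega> \<in> space N. \<bar>X \<omega>\<bar> \<ge> t} \<le> 2 * exp (- (t\<^sup>2) / K\<^sup>2))"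

end

theory Submission
  imports Defs
begin

text \<open>
  Let \<open>L\<close> be the span of the differences \<open>v i - v j\<close> with \<open>i\<close>, \<open>j\<close> in the pattern of \<open>\<beta>0\<close>; the
  pattern space is orthogonal to \<open>L\<close>, while the affine hull of the subdifferential at \<open>\<beta>0\<close> is
  closed under translations by \<open>L\<close>. A subgradient in the relative interior that is orthogonal
  to \<open>L\<close> therefore makes the directional derivative of \<open>f\<close> at \<open>\<beta>0\<close> grow at a linear rate
  \<open>\<delta> * norm e\<close> in every direction \<open>e \<in> L\<close>. If the observation is within \<open>\<delta> * \<tau> / 2\<close> of \<open>\<beta>0\<close>
  and \<open>\<tau>\<close> is small, then removing from the proximal point its displacement along \<open>L\<close> would
  lower the proximal objective, so this displacement vanishes and the pattern is that of \<open>\<beta>0\<close>.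
  With \<open>\<tau> = \<alpha> / sqrt n\<close> the condition reads \<open>norm (sqrt n (\<beta>1 - \<beta>0)) < \<delta> * \<alpha> / 2\<close>, whose
  asymptotic probability is controlled by the sub-gaussian tail of \<open>norm W\<close>.
\<close>

section \<open>Subgradients and proximal points\<close>

text \<open>Restricting \<open>g\<close> to the line through \<open>x\<close> and \<open>y\<close>
  reduces the claim to the tangent inequality for convex functions of one real variable.\<close>

lemma gradient_in_subdifferential:
  fixes g :: "'a::real_inner \<Rightarrow> real"
  assumes "convex_on UNIV g" and "GDERIV g x :> D"
  shows "D \<in> subdifferential g x"
proof -
  have "g y \<ge> g x + D \<bullet> (y - x)" for y
  proof -
    define \<phi> where "\<phi> t = g (x + t *\<^sub>R (y - x))" for t :: real
    have "convex_on UNIV \<phi>"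
    proof (rule convex_onI)
      fix t a b :: real
      assume "0 < t" "t < 1"
      have "x + ((1 - t) *\<^sub>R a + t *\<^sub>R b) *\<^sub>R (y - x)
          = (1 - t) *\<^sub>R (x + a *\<^sub>R (y - x)) + t *\<^sub>R (x + b *\<^sub>R (y - x))"
        by (simp add: algebra_simps)
      then show "\<phi> ((1 - t) *\<^sub>R a + t *\<^sub>R b) \<le> (1 - t) * \<phi> a + t * \<phi> b"
        unfolding \<phi>_def
        using convex_onD[OF assms(1), of t "x + a *\<^sub>R (y - x)" "x + b *\<^sub>R (y - x)"]
          \<open>0 < t\<close> \<open>t < 1\<close> by simp
    qed auto
    moreover have "(\<phi> has_field_derivative D \<bullet> (y - x)) (at 0)"
    proof -
      have "((\<lambda>t. x + t *\<^sub>R (y - x)) has_derivative (\<lambda>t. t *\<^sub>R (y - x))) (at 0)"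
        by (auto intro!: derivative_eq_intros)
      moreover have "(g has_derivative (\<lambda>h. h \<bullet> D)) (at (x + 0 *\<^sub>R (y - x)))"
        using assms(2) by (simp add: gderiv_def)
      ultimately have "(\<phi> has_derivative (\<lambda>t. (t *\<^sub>R (y - x)) \<bullet> D)) (at 0)"
        unfolding \<phi>_def using has_derivative_compose by blast
      then show ?thesis
        by (rule has_derivative_imp_has_field_derivative)
          (simp add: inner_commute mult.commute)
    qed
    ultimately have "\<phi> 1 - \<phi> 0 \<ge> D \<bullet> (y - x) * (1 - 0)"
      by (intro convex_on_imp_above_tangent[where A = UNIV]) auto
    then show ?thesis
      by (simp add: \<phi>_def)
  qed
  then show ?thesis
    by (simp add: subdifferential_def)
qed

lemma subdifferential_cmult:
  assumes "s \<in> subdifferential f x" and "0 \<le> c"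
  shows "c *\<^sub>R s \<in> subdifferential (\<lambda>x. c * f x) x"
proof -
  have "c * (f x + s \<bullet> (y - x)) \<le> c * f y" for y
    using assms by (intro mult_left_mono) (auto simp: subdifferential_def)
  then show ?thesis
    by (simp add: subdifferential_def distrib_left)
qed

text \<open>The lower bound is quadratic in \<open>norm (y - x0)\<close>. It yields coercivity,
  hence existence of a minimiser, and also bounds the distance from the minimiser to
  \<open>x0\<close>.\<close>

lemma prox_objective_growth:
  fixes h :: "'a::real_inner \<Rightarrow> real"
  assumes "s \<in> subdifferential h x0"
  shows "1/2 * (norm (\<beta> - y))\<^sup>2 + h y
    \<ge> 1/2 * (norm (\<beta> - x0))\<^sup>2 + h x0
      + norm (y - x0) * (1/2 * norm (y - x0) - (norm (\<beta> - x0) + norm s))"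
proof -
  have "h y \<ge> h x0 + s \<bullet> (y - x0)"
    using assms by (simp add: subdifferential_def)
  moreover have "s \<bullet> (y - x0) \<ge> - (norm s * norm (y - x0))"
    using Cauchy_Schwarz_ineq2[of s "y - x0"] by linarith
  moreover have "(\<beta> - x0) \<bullet> (y - x0) \<le> norm (\<beta> - x0) * norm (y - x0)"
    by (rule norm_cauchy_schwarz)
  moreover have "(norm (\<beta> - y))\<^sup>2
      = (norm (\<beta> - x0))\<^sup>2 - 2 * ((\<beta> - x0) \<bullet> (y - x0)) + (norm (y - x0))\<^sup>2"
    by (simp add: power2_norm_eq_inner inner_diff_left inner_diff_right inner_commute)
  ultimately show ?thesis
    by (simp add: algebra_simps power2_eq_square)
qed

lemma prox_minimal:
  fixes h :: "'a::euclidean_space \<Rightarrow> real"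
  assumes "continuous_on UNIV h" and s: "s \<in> subdifferential h x0"
  shows "1/2 * (norm (\<beta> - prox h \<beta>))\<^sup>2 + h (prox h \<beta>) \<le> 1/2 * (norm (\<beta> - y))\<^sup>2 + h y"
proof -
  define F where "F y = 1/2 * (norm (\<beta> - y))\<^sup>2 + h y" for y
  \<comment> \<open>Outside the ball of this radius the last factor of the growth bound is
    nonnegative, so no value there is below \<open>F x0\<close>; minimising over the compact ball is
    enough.\<close>
  define R where "R = 2 * (norm (\<beta> - x0) + norm s)"
  have "continuous_on (cball x0 R) F"
    unfolding F_def
    by (intro continuous_intros continuous_on_subset[OF assms(1)]) auto
  moreover have "x0 \<in> cball x0 R"
    by (simp add: R_def)
  ultimately obtain z where z: "z \<in> cball x0 R" "\<And>y. y \<in> cball x0 R \<Longrightarrow> F z \<le> F y"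
    using continuous_attains_inf[of "cball x0 R" F] by auto
  have "F z \<le> F y" for y
  proof (cases "y \<in> cball x0 R")
    case False
    then have "1/2 * norm (y - x0) - (norm (\<beta> - x0) + norm s) \<ge> 0"
      by (simp add: R_def dist_norm norm_minus_commute)
    then have "norm (y - x0) * (1/2 * norm (y - x0) - (norm (\<beta> - x0) + norm s)) \<ge> 0"
      by (intro mult_nonneg_nonneg) auto
    then have "F x0 \<le> F y"
      using prox_objective_growth[OF s, of \<beta> y] unfolding F_def by linarith
    moreover have "F z \<le> F x0"
      by (rule z) fact
    ultimately show ?thesis
      by simp
  qed (use z in auto)
  then have "is_arg_min F (\<lambda>_. True) z"
    by (simp add: is_arg_min_linorder)
  then have "is_arg_min F (\<lambda>_. True) (prox h \<beta>)"
    unfolding prox_def arg_min_def F_def by (rule someI)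
  then show ?thesis
    by (simp add: is_arg_min_linorder F_def)
qed

text \<open>Since the proximal point does at least as well as \<open>x0\<close>, the product in the
  growth bound cannot be positive at it.\<close>

lemma norm_prox_minus_le:
  fixes h :: "'a::euclidean_space \<Rightarrow> real"
  assumes "continuous_on UNIV h" and s: "s \<in> subdifferential h x0"
  shows "norm (prox h \<beta> - x0) \<le> 2 * (norm (\<beta> - x0) + norm s)"
proof -
  have "norm (prox h \<beta> - x0) * (1/2 * norm (prox h \<beta> - x0) - (norm (\<beta> - x0) + norm s)) \<le> 0"
    using prox_objective_growth[OF s, of \<beta> "prox h \<beta>"] prox_minimal[OF assms, of \<beta> x0]
    by linarith
  then show ?thesis
    by (auto simp: mult_le_0_iff)
qed

text \<open>First-order optimality: compare the proximal point with points of the segment towards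
  \<open>y\<close>, divide by the step \<open>t\<close> and let \<open>t\<close> tend to 0 from the
  right.\<close>

lemma prox_subgradient:
  fixes h :: "'a::euclidean_space \<Rightarrow> real"
  assumes "convex_on UNIV h" and "s \<in> subdifferential h x0"
  shows "\<beta> - prox h \<beta> \<in> subdifferential h (prox h \<beta>)"
proof -
  define \<xi> where "\<xi> = prox h \<beta>"
  have cont: "continuous_on UNIV h"
    using convex_on_continuous[OF open_UNIV] assms(1) by blast
  have "h y \<ge> h \<xi> + (\<beta> - \<xi>) \<bullet> (y - \<xi>)" for y
  proof -
    have "h y - h \<xi> - (\<beta> - \<xi>) \<bullet> (y - \<xi>) + t * (1/2 * (norm (y - \<xi>))\<^sup>2) \<ge> 0"
      if t: "0 < t" "t < 1" for t
    proof -
      define w where "w = (1 - t) *\<^sub>R \<xi> + t *\<^sub>R y"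
      have "h w \<le> (1 - t) * h \<xi> + t * h y"
        unfolding w_def using convex_onD[OF assms(1), of t \<xi> y] t by simp
      moreover have "1/2 * (norm (\<beta> - \<xi>))\<^sup>2 + h \<xi> \<le> 1/2 * (norm (\<beta> - w))\<^sup>2 + h w"
        unfolding \<xi>_def by (rule prox_minimal[OF cont assms(2)])
      moreover have "(norm (\<beta> - w))\<^sup>2
          = (norm (\<beta> - \<xi>))\<^sup>2 - 2 * t * ((\<beta> - \<xi>) \<bullet> (y - \<xi>)) + t * t * (norm (y - \<xi>))\<^sup>2"
      proof -
        have w: "\<beta> - w = (\<beta> - \<xi>) - t *\<^sub>R (y - \<xi>)"
          by (simp add: w_def algebra_simps)
        show ?thesis
          unfolding w power2_norm_eq_inner
          by (simp add: inner_diff_left inner_diff_right inner_commute algebra_simps)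
      qed
      ultimately have
        "0 \<le> t * (h y - h \<xi> - (\<beta> - \<xi>) \<bullet> (y - \<xi>) + t * (1/2 * (norm (y - \<xi>))\<^sup>2))"
        by (simp add: algebra_simps)
      then show ?thesis
        using t by (simp add: zero_le_mult_iff)
    qed
    then have "eventually (\<lambda>t. h y - h \<xi> - (\<beta> - \<xi>) \<bullet> (y - \<xi>)
        + t * (1/2 * (norm (y - \<xi>))\<^sup>2) \<ge> 0) (at_right (0::real))"
      unfolding eventually_at_right_field by (meson zero_less_one)
    moreover have "((\<lambda>t. h y - h \<xi> - (\<beta> - \<xi>) \<bullet> (y - \<xi>) + t * (1/2 * (norm (y - \<xi>))\<^sup>2))
        \<longlongrightarrow> h y - h \<xi> - (\<beta> - \<xi>) \<bullet> (y - \<xi>) + 0 * (1/2 * (norm (y - \<xi>))\<^sup>2))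
        (at_right (0::real))"
      by (intro tendsto_intros)
    ultimately have
      "0 \<le> h y - h \<xi> - (\<beta> - \<xi>) \<bullet> (y - \<xi>) + 0 * (1/2 * (norm (y - \<xi>))\<^sup>2)"
      by (intro tendsto_lowerbound) auto
    then show ?thesis
      by simp
  qed
  then show ?thesis
    by (simp add: subdifferential_def \<xi>_def)
qed

text \<open>Adding the two subgradient inequalities at the proximal points, each evaluated at the
  other point, gives monotonicity; Cauchy-Schwarz does the rest. The resulting continuity makes the
  recovery event measurable.\<close>

lemma prox_nonexpansive:
  fixes h :: "'a::euclidean_space \<Rightarrow> real"
  assumes "convex_on UNIV h" and "s \<in> subdifferential h x0"
  shows "norm (prox h a - prox h b) \<le> norm (a - b)"
proof -
  let ?p = "prox h a" and ?q = "prox h b"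
  have "h ?q \<ge> h ?p + (a - ?p) \<bullet> (?q - ?p)" "h ?p \<ge> h ?q + (b - ?q) \<bullet> (?p - ?q)"
    using prox_subgradient[OF assms] by (simp_all add: subdifferential_def)
  then have "(?p - ?q) \<bullet> (?p - ?q) \<le> (a - b) \<bullet> (?p - ?q)"
    by (simp add: inner_diff_left inner_diff_right inner_commute)
  also have "\<dots> \<le> norm (a - b) * norm (?p - ?q)"
    by (rule norm_cauchy_schwarz)
  finally have "norm (?p - ?q) * norm (?p - ?q) \<le> norm (a - b) * norm (?p - ?q)"
    by (simp add: power2_norm_eq_inner[symmetric] power2_eq_square)
  then show ?thesis
    by (cases "?p = ?q") auto
qed

lemma continuous_on_prox:
  fixes h :: "'a::euclidean_space \<Rightarrow> real"
  assumes "convex_on UNIV h" and "s \<in> subdifferential h x0"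
  shows "continuous_on UNIV (prox h)"
  unfolding continuous_on_iff
  using prox_nonexpansive[OF assms] by (auto simp: dist_norm intro: order_le_less_trans)

section \<open>Patterns\<close>

lemma pattern_iff: "i \<in> pattern S v x \<longleftrightarrow> i \<in> S \<and> (\<forall>j\<in>S. v j \<bullet> x \<le> v i \<bullet> x)"
  by (auto simp: pattern_def is_arg_max_linorder)

lemma pattern_nonempty:
  assumes "finite S" "S \<noteq> {}"
  shows "pattern S v x \<noteq> {}"
proof -
  have "Max ((\<lambda>i. v i \<bullet> x) ` S) \<in> (\<lambda>i. v i \<bullet> x) ` S"
    using assms by simp
  then obtain i where "i \<in> S" "v i \<bullet> x = Max ((\<lambda>i. v i \<bullet> x) ` S)"
    by auto
  then have "i \<in> pattern S v x"
    using assms by (simp add: pattern_iff)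
  then show ?thesis
    by auto
qed

lemma pattern_measurable:
  fixes v :: "'i \<Rightarrow> real ^ 'p"
  assumes "finite S"
  shows "{x. pattern S v x = pattern S v \<beta>0} \<in> sets borel"
proof -
  have "{x. pattern S v x = pattern S v \<beta>0}
      = {x \<in> space borel. \<forall>i\<in>S. (\<forall>j\<in>S. v j \<bullet> x \<le> v i \<bullet> x) \<longleftrightarrow> i \<in> pattern S v \<beta>0}"
    by (auto simp: set_eq_iff pattern_iff)
  also have "\<dots> \<in> sets borel"
    using assms by measurable
  finally show ?thesis .
qed

text \<open>An index outside the pattern at \<open>x0\<close> is strictly beaten there by some
  \<open>j\<close>. Strict inequalities persist nearby, and only finitely many indices are
  concerned.\<close>

lemma pattern_locally_subset:
  fixes v :: "'i \<Rightarrow> real ^ 'p"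
  assumes "finite S"
  shows "\<forall>\<^sub>F x in nhds x0. pattern S v x \<subseteq> pattern S v x0"
proof -
  have "\<forall>\<^sub>F x in nhds x0. i \<notin> pattern S v x" if i: "i \<in> S - pattern S v x0" for i
  proof -
    obtain j where j: "j \<in> S" "v i \<bullet> x0 < v j \<bullet> x0"
      using i by (auto simp: pattern_iff not_le)
    have "open {x. v i \<bullet> x < v j \<bullet> x}"
      by (intro open_Collect_less continuous_intros)
    then have "\<forall>\<^sub>F x in nhds x0. v i \<bullet> x < v j \<bullet> x"
      using j eventually_nhds_in_open by fastforce
    then show ?thesis
      by eventually_elim (use j in \<open>auto simp: pattern_iff not_le\<close>)
  qed
  then have "\<forall>\<^sub>F x in nhds x0. \<forall>i\<in>S - pattern S v x0. i \<notin> pattern S v x"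
    using assms by (subst eventually_ball_finite_distrib) auto
  then show ?thesis
    by eventually_elim (auto dest: pattern_iff[THEN iffD1])
qed

text \<open>The space \<open>L\<close> of the overview: the direction space of the affine hull of
  the active \<open>v i\<close>. Taking all pairs avoids fixing a base index.\<close>

definition pattern_directions :: "'i set \<Rightarrow> ('i \<Rightarrow> real ^ 'p) \<Rightarrow> real ^ 'p \<Rightarrow> (real ^ 'p) set"
  where "pattern_directions S v x =
    span {v i - v j | i j. i \<in> pattern S v x \<and> j \<in> pattern S v x}"

text \<open>All indices of the pattern of a generator \<open>w\<close> attain the same maximal value
  at \<open>w\<close>, so \<open>w\<close> annihilates every difference; bilinearity extends this to
  both spans.\<close>

lemma pattern_space_orthogonal:
  assumes "u \<in> pattern_space S v x" and "e \<in> pattern_directions S v x"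
  shows "u \<bullet> e = 0"
proof -
  have *: "w \<bullet> e = 0" if w: "pattern S v w = pattern S v x" for w
  proof -
    have "orthogonal w e"
      using assms(2) unfolding pattern_directions_def
    proof (rule orthogonal_to_span)
      fix d assume "d \<in> {v i - v j |i j. i \<in> pattern S v x \<and> j \<in> pattern S v x}"
      then obtain i j where "d = v i - v j" "i \<in> pattern S v w" "j \<in> pattern S v w"
        unfolding w by blast
      then show "orthogonal w d"
        by (auto simp: orthogonal_def inner_diff_right pattern_iff inner_commute
            intro!: antisym)
    qed
    then show ?thesis
      by (simp add: orthogonal_def)
  qed
  have "orthogonal e u"
    using assms(1) unfolding pattern_space_def
    by (rule orthogonal_to_span) (use * in \<open>auto simp: orthogonal_def inner_commute\<close>)
  then show ?thesis
    by (simp add: orthogonal_def inner_commute)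
qed

text \<open>Orthogonality makes all indices active at \<open>x0\<close> tie at \<open>x\<close>. One
  of them is maximal there, hence all are.\<close>

lemma pattern_eqI:
  assumes "finite S" "S \<noteq> {}"
    and sub: "pattern S v x \<subseteq> pattern S v x0"
    and orth: "\<And>e. e \<in> pattern_directions S v x0 \<Longrightarrow> x \<bullet> e = 0"
  shows "pattern S v x = pattern S v x0"
proof (rule antisym[OF sub], rule subsetI)
  fix j assume j: "j \<in> pattern S v x0"
  obtain i where i: "i \<in> pattern S v x"
    using pattern_nonempty[OF assms(1,2)] by blast
  have "v i - v j \<in> pattern_directions S v x0"
    unfolding pattern_directions_def using i j sub by (intro span_base) auto
  from orth[OF this] have "v i \<bullet> x = v j \<bullet> x"
    by (simp add: inner_diff_right inner_commute)
  then show "j \<in> pattern S v x"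
    using i j by (simp add: pattern_iff)
qed

section \<open>Penalties of max-linear form\<close>

lemma max_linear_form_ge:
  assumes "max_linear_form S v g f" "i \<in> S"
  shows "v i \<bullet> x + g x \<le> f x"
  using assms by (simp add: max_linear_form_def)

lemma max_linear_form_eq:
  assumes "max_linear_form S v g f" "i \<in> pattern S v x"
  shows "f x = v i \<bullet> x + g x"
proof -
  have "Max ((\<lambda>i. v i \<bullet> x) ` S) = v i \<bullet> x"
    using assms by (intro Max_eqI) (auto simp: max_linear_form_def pattern_iff)
  then show ?thesis
    using assms(1) by (simp add: max_linear_form_def)
qed

text \<open>With \<open>i\<close> active at the intermediate point, the convex function
  \<open>v i \<bullet> x + g x\<close> equals \<open>f\<close> there and stays below
  \<open>f\<close> at both endpoints.\<close>

lemma max_linear_form_convex: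
  fixes v :: "'i \<Rightarrow> real ^ 'p"
  assumes "max_linear_form S v g f"
  shows "convex_on UNIV f"
proof (rule convex_onI)
  fix t :: real and x y :: "real ^ 'p"
  assume t: "0 < t" "t < 1"
  let ?z = "(1 - t) *\<^sub>R x + t *\<^sub>R y"
  have fin: "finite S" "S \<noteq> {}" and g: "convex_on UNIV g"
    using assms by (auto simp: max_linear_form_def)
  obtain i where i: "i \<in> pattern S v ?z"
    using pattern_nonempty[OF fin] by blast
  then have "i \<in> S"
    by (simp add: pattern_iff)
  have "f ?z = v i \<bullet> ?z + g ?z"
    by (rule max_linear_form_eq[OF assms i])
  also have "\<dots> \<le> (1 - t) * (v i \<bullet> x + g x) + t * (v i \<bullet> y + g y)"
    using convex_onD[OF g, of t x y] t by (simp add: inner_add_right algebra_simps)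
  also have "\<dots> \<le> (1 - t) * f x + t * f y"
    using max_linear_form_ge[OF assms \<open>i \<in> S\<close>] t
    by (intro add_mono mult_left_mono) auto
  finally show "f ?z \<le> (1 - t) * f x + t * f y" .
qed auto

lemma max_linear_form_subgradient:
  assumes f: "max_linear_form S v g f"
    and g': "g' \<in> subdifferential g x" and i: "i \<in> pattern S v x"
  shows "v i + g' \<in> subdifferential f x"
proof -
  have "f y \<ge> f x + (v i + g') \<bullet> (y - x)" for y
    using max_linear_form_ge[OF f, of i y] max_linear_form_eq[OF f i] i g'
    by (auto simp: subdifferential_def pattern_iff inner_add_left inner_diff_right
        dest: spec[of _ y])
  then show ?thesis
    by (simp add: subdifferential_def)
qed

text \<open>For active \<open>i\<close> and \<open>j\<close>, both \<open>v i + g'\<close> and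
  \<open>v j + g'\<close> are subgradients, and \<open>g'\<close> cancels in their difference. So
  the direction space of the affine hull contains the generators of \<open>L\<close>.\<close>

lemma pattern_directions_affine_hull:
  assumes f: "max_linear_form S v g f" and g': "g' \<in> subdifferential g x"
    and s: "s \<in> subdifferential f x" and e: "e \<in> pattern_directions S v x"
  shows "s + e \<in> affine hull (subdifferential f x)"
proof -
  let ?A = "affine hull (subdifferential f x)"
  have sA: "s \<in> ?A"
    using s by (rule hull_inc)
  have sub: "subspace ((\<lambda>y. (- s) + y) ` ?A)"
    by (rule affine_diffs_subspace[OF affine_affine_hull sA])
  have "pattern_directions S v x \<subseteq> (\<lambda>y. (- s) + y) ` ?A"
    unfolding pattern_directions_def
  proof (rule span_minimal[OF _ sub], rule subsetI)
    fix d assume "d \<in> {v i - v j |i j. i \<in> pattern S v x \<and> j \<in> pattern S v x}"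
    then obtain i j where d: "d = v i - v j" "i \<in> pattern S v x" "j \<in> pattern S v x"
      by auto
    have "s + 1 *\<^sub>R ((v i + g') - (v j + g')) \<in> ?A"
      using d by (intro mem_affine_3_minus sA affine_affine_hull hull_inc
          max_linear_form_subgradient[OF f g'])
    then show "d \<in> (\<lambda>y. (- s) + y) ` ?A"
      by (intro image_eqI[where x = "s + d"]) (auto simp: d)
  qed
  with e show ?thesis
    by auto
qed

text \<open>Relative interiority allows \<open>s\<close> to be shifted by length
  \<open>\<rho>\<close> along any direction of \<open>L\<close>. The growth this forces is
  transferred to an explicit subgradient \<open>v i + g' x0\<close> by testing at a nearby point.
  The index may depend on \<open>e\<close>, but the rate \<open>\<rho> / 2\<close> does not.\<close>

lemma rel_interior_linear_growth:
  assumes f: "max_linear_form S v g f"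
    and g': "\<And>x. g' x \<in> subdifferential g x" "continuous_on UNIV g'"
    and s: "s \<in> pattern_space S v x0" "s \<in> rel_interior (subdifferential f x0)"
  obtains \<delta> where "\<delta> > 0"
    "\<And>e. e \<in> pattern_directions S v x0 \<Longrightarrow>
      \<exists>i\<in>pattern S v x0. \<delta> * norm e \<le> (v i + g' x0) \<bullet> e"
proof -
  have fin: "finite S" "S \<noteq> {}"
    using f by (auto simp: max_linear_form_def)
  obtain \<rho> where \<rho>: "\<rho> > 0"
    "cball s \<rho> \<inter> affine hull (subdifferential f x0) \<subseteq> subdifferential f x0"
    and sC: "s \<in> subdifferential f x0"
    using s(2) unfolding mem_rel_interior_cball by auto
  have "\<exists>i\<in>pattern S v x0. \<rho> / 2 * norm e \<le> (v i + g' x0) \<bullet> e"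
    if e: "e \<in> pattern_directions S v x0" for e
  proof (cases "e = 0")
    case True
    then show ?thesis
      using pattern_nonempty[OF fin] by auto
  next
    case False
    \<comment> \<open>As \<open>s\<close> is orthogonal to \<open>e\<close>, the slope of this
      subgradient along \<open>e\<close> comes from the shift alone and equals
      \<open>\<rho> * norm e\<close>.\<close>
    define q where "q = s + (\<rho> / norm e) *\<^sub>R e"
    have "(\<rho> / norm e) *\<^sub>R e \<in> pattern_directions S v x0"
      using e unfolding pattern_directions_def by (rule span_mul)
    then have "q \<in> affine hull (subdifferential f x0)"
      unfolding q_def by (rule pattern_directions_affine_hull[OF f g'(1) sC])
    moreover have "q \<in> cball s \<rho>"
      using \<rho>(1) False by (simp add: q_def dist_norm)
    ultimately have q: "q \<in> subdifferential f x0"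
      using \<rho>(2) by blast
    have qe: "q \<bullet> e = \<rho> * norm e"
      using pattern_space_orthogonal[OF s(1) e] False
      by (simp add: q_def inner_add_left power2_norm_eq_inner[symmetric] power2_eq_square)
    have "\<forall>\<^sub>F x in nhds x0. dist (g' x) (g' x0) < \<rho> / 2"
      using g'(2) \<rho>(1) by (intro tendstoD)
        (auto simp: continuous_on_eq_continuous_at isCont_def tendsto_at_iff_tendsto_nhds)
    then have "\<forall>\<^sub>F x in nhds x0. dist (g' x) (g' x0) < \<rho> / 2 \<and> pattern S v x \<subseteq> pattern S v x0"
      using pattern_locally_subset[OF fin(1)] by (rule eventually_conj)
    then obtain \<epsilon> where \<epsilon>: "\<epsilon> > 0"
      "\<And>x. dist x x0 < \<epsilon> \<Longrightarrow> dist (g' x) (g' x0) < \<rho> / 2 \<and> pattern S v x \<subseteq> pattern S v x0"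
      unfolding eventually_nhds_metric by auto
    \<comment> \<open>This step puts \<open>y\<close> at distance \<open>\<epsilon> / 2\<close> from
      \<open>x0\<close>: indices active at \<open>y\<close> are active at \<open>x0\<close>, and
      replacing \<open>g' y\<close> by \<open>g' x0\<close> costs at most half of the slope.\<close>
    define t where "t = \<epsilon> / (2 * norm e)"
    define y where "y = x0 + t *\<^sub>R e"
    have t: "t > 0"
      using \<epsilon>(1) False by (simp add: t_def)
    have y: "dist y x0 < \<epsilon>"
      using \<epsilon>(1) False by (simp add: y_def t_def dist_norm)
    obtain i where i: "i \<in> pattern S v y"
      using pattern_nonempty[OF fin] by blast
    then have i0: "i \<in> pattern S v x0"
      using \<epsilon>(2)[OF y] by auto
    have "f y \<ge> f x0 + q \<bullet> (y - x0)"
      using q by (simp add: subdifferential_def)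
    \<comment> \<open>The gradient is taken at \<open>y\<close>, because an upper bound on the
      increment \<open>g y - g x0\<close> is needed.\<close>
    moreover have "g x0 \<ge> g y + g' y \<bullet> (x0 - y)"
      using g'(1)[of y] by (simp add: subdifferential_def)
    ultimately have "t * (q \<bullet> e) \<le> t * ((v i + g' y) \<bullet> e)"
      using max_linear_form_eq[OF f i] max_linear_form_eq[OF f i0]
      by (simp add: y_def inner_add_left inner_add_right algebra_simps)
    then have "\<rho> * norm e \<le> (v i + g' y) \<bullet> e"
      using t qe by simp
    also have "\<dots> = (v i + g' x0) \<bullet> e + (g' y - g' x0) \<bullet> e"
      by (simp add: inner_add_left inner_diff_left)
    also have "(g' y - g' x0) \<bullet> e \<le> norm (g' y - g' x0) * norm e"
      by (rule norm_cauchy_schwarz)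
    also have "\<dots> \<le> \<rho> / 2 * norm e"
      using \<epsilon>(2)[OF y] by (intro mult_right_mono) (auto simp: dist_norm)
    finally have "\<rho> / 2 * norm e \<le> (v i + g' x0) \<bullet> e"
      by simp
    with i0 show ?thesis
      by blast
  qed
  with \<rho>(1) show ?thesis
    by (intro that[of "\<rho> / 2"]) auto
qed

text \<open>The deterministic core: \<open>\<delta>\<close> and \<open>\<eta>\<close> are fixed
  before \<open>\<tau>\<close> and \<open>\<beta>\<close>, so the statement applies to each outcome
  separately while \<open>\<tau>\<close> shrinks with the sample size.\<close>

lemma prox_pattern_recovery:
  assumes f: "max_linear_form S v g f"
    and ri: "pattern_space S v \<beta>0 \<inter> rel_interior (subdifferential f \<beta>0) \<noteq> {}"
  obtains \<delta> \<eta> where "\<delta> > 0" "\<eta> > 0"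
    "\<And>\<tau> \<beta>. 0 < \<tau> \<Longrightarrow> \<tau> < \<eta> \<Longrightarrow> norm (\<beta> - \<beta>0) < \<delta> * \<tau> \<Longrightarrow>
      pattern S v (prox (\<lambda>x. \<tau> * f x) \<beta>) = pattern S v \<beta>0"
proof -
  have fin: "finite S" "S \<noteq> {}"
    using f by (auto simp: max_linear_form_def)
  obtain g' where "\<And>x. GDERIV g x :> g' x" and g'_cont: "continuous_on UNIV g'"
    using f by (auto simp: max_linear_form_def)
  then have g': "g' x \<in> subdifferential g x" for x
    using f by (intro gradient_in_subdifferential) (auto simp: max_linear_form_def)
  obtain s where s: "s \<in> pattern_space S v \<beta>0" "s \<in> rel_interior (subdifferential f \<beta>0)"
    using ri by auto
  then have sC: "s \<in> subdifferential f \<beta>0"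
    using rel_interior_subset by blast
  obtain \<delta> where \<delta>: "\<delta> > 0" "\<And>e. e \<in> pattern_directions S v \<beta>0 \<Longrightarrow>
      \<exists>i\<in>pattern S v \<beta>0. \<delta> * norm e \<le> (v i + g' \<beta>0) \<bullet> e"
    using rel_interior_linear_growth[OF f g' g'_cont s] by blast
  have "\<forall>\<^sub>F x in nhds \<beta>0. dist (g' x) (g' \<beta>0) < \<delta> / 2"
    using g'_cont \<delta>(1) by (intro tendstoD)
      (auto simp: continuous_on_eq_continuous_at isCont_def tendsto_at_iff_tendsto_nhds)
  then have "\<forall>\<^sub>F x in nhds \<beta>0. dist (g' x) (g' \<beta>0) < \<delta> / 2 \<and> pattern S v x \<subseteq> pattern S v \<beta>0"
    using pattern_locally_subset[OF fin(1)] by (rule eventually_conj)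
  then obtain \<epsilon> where \<epsilon>: "\<epsilon> > 0"
    "\<And>x. dist x \<beta>0 < \<epsilon> \<Longrightarrow> dist (g' x) (g' \<beta>0) < \<delta> / 2 \<and> pattern S v x \<subseteq> pattern S v \<beta>0"
    unfolding eventually_nhds_metric by auto
  \<comment> \<open>Chosen so that the distance bound for the proximal point, which is below
    \<open>2 * \<tau> * (\<delta> / 2 + norm s)\<close>, stays below
    \<open>\<epsilon>\<close>.\<close>
  define \<eta> where "\<eta> = \<epsilon> / (2 * (\<delta> / 2 + norm s))"
  have pos: "\<delta> / 2 + norm s > 0"
    using \<delta>(1) by (simp add: add_pos_nonneg)
  have "pattern S v (prox (\<lambda>x. \<tau> * f x) \<beta>) = pattern S v \<beta>0"
    if \<tau>: "0 < \<tau>" "\<tau> < \<eta>" and \<beta>: "norm (\<beta> - \<beta>0) < \<delta> / 2 * \<tau>" for \<tau> \<beta>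
  proof -
    define \<xi> where "\<xi> = prox (\<lambda>x. \<tau> * f x) \<beta>"
    have cont: "continuous_on UNIV (\<lambda>x. \<tau> * f x)"
      using convex_on_continuous[OF open_UNIV max_linear_form_convex[OF f]]
      by (intro continuous_intros)
    have sub: "\<tau> *\<^sub>R s \<in> subdifferential (\<lambda>x. \<tau> * f x) \<beta>0"
      using sC \<tau> by (intro subdifferential_cmult) auto
    have "norm (\<xi> - \<beta>0) \<le> 2 * (norm (\<beta> - \<beta>0) + norm (\<tau> *\<^sub>R s))"
      unfolding \<xi>_def by (rule norm_prox_minus_le[OF cont sub])
    also have "\<dots> < \<tau> * (2 * (\<delta> / 2 + norm s))"
      using \<beta> \<tau> by (simp add: algebra_simps)
    also have "\<dots> < \<epsilon>"
      using \<tau>(2) pos by (simp add: \<eta>_def pos_less_divide_eq)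
    finally have near: "norm (\<xi> - \<beta>0) < \<epsilon>" .
    obtain e a where e: "e \<in> pattern_directions S v \<beta>0"
      and a: "\<And>w. w \<in> pattern_directions S v \<beta>0 \<Longrightarrow> orthogonal a w"
      and ea: "\<xi> - \<beta>0 = e + a"
      unfolding pattern_directions_def
      by (rule orthogonal_subspace_decomp_exists[of
            "{v i - v j |i j. i \<in> pattern S v \<beta>0 \<and> j \<in> pattern S v \<beta>0}" "\<xi> - \<beta>0"]) blast
    \<comment> \<open>The competitor: the displacement of \<open>\<xi>\<close> from
      \<open>\<beta>0\<close> with its component \<open>e\<close> along \<open>L\<close> removed. By
      Pythagoras it is no farther from \<open>\<beta>0\<close> than \<open>\<xi>\<close>.\<close>
    define \<xi>' where "\<xi>' = \<beta>0 + a"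
    have \<beta>0_space: "\<beta>0 \<in> pattern_space S v \<beta>0"
      unfolding pattern_space_def by (rule span_base) simp
    have "(norm (e + a))\<^sup>2 = (norm e)\<^sup>2 + (norm a)\<^sup>2"
      using a[OF e] by (intro norm_add_Pythagorean) (simp add: orthogonal_commute)
    then have "(norm a)\<^sup>2 \<le> (norm (e + a))\<^sup>2"
      using zero_le_power2[of "norm e"] by linarith
    then have "norm a \<le> norm (e + a)"
      by (rule power2_le_imp_le) (rule norm_ge_zero)
    then have "norm a < \<epsilon>"
      using near unfolding ea by (rule order_le_less_trans)
    then have near': "dist \<xi>' \<beta>0 < \<epsilon>"
      by (simp add: \<xi>'_def dist_norm)
    have pat: "pattern S v \<xi>' = pattern S v \<beta>0"
    proof (rule pattern_eqI[OF fin])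
      show "pattern S v \<xi>' \<subseteq> pattern S v \<beta>0"
        using \<epsilon>(2)[OF near'] by simp
      show "\<xi>' \<bullet> w = 0" if "w \<in> pattern_directions S v \<beta>0" for w
        using pattern_space_orthogonal[OF \<beta>0_space that] a[OF that]
        by (simp add: \<xi>'_def inner_add_left orthogonal_def)
    qed
    have \<xi>: "\<xi> = \<xi>' + e"
      using ea by (simp add: \<xi>'_def algebra_simps)
    have "e = 0"
    proof (rule ccontr)
      assume "e \<noteq> 0"
      obtain i where i: "i \<in> pattern S v \<beta>0" "\<delta> * norm e \<le> (v i + g' \<beta>0) \<bullet> e"
        using \<delta>(2)[OF e] by blast
      have "g \<xi> \<ge> g \<xi>' + g' \<xi>' \<bullet> e"
        using g'[of \<xi>'] by (auto simp: subdifferential_def \<xi> dest: spec[of _ \<xi>])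
      \<comment> \<open>The competitor has the pattern of \<open>\<beta>0\<close>, so the index
        \<open>i\<close> is active there and \<open>f\<close> is known exactly; at
        \<open>\<xi>\<close> a lower bound is enough.\<close>
      moreover have "f \<xi>' = v i \<bullet> \<xi>' + g \<xi>'"
        using i pat by (intro max_linear_form_eq[OF f]) simp
      moreover have "f \<xi> \<ge> v i \<bullet> \<xi> + g \<xi>"
        using i by (intro max_linear_form_ge[OF f]) (simp add: pattern_iff)
      ultimately have "f \<xi> - f \<xi>' \<ge> (v i + g' \<beta>0) \<bullet> e + (g' \<xi>' - g' \<beta>0) \<bullet> e"
        by (simp add: \<xi> inner_add_left inner_add_right inner_diff_left)
      moreover have "(g' \<xi>' - g' \<beta>0) \<bullet> e \<ge> - (\<delta> / 2 * norm e)"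
      proof -
        have "\<bar>(g' \<xi>' - g' \<beta>0) \<bullet> e\<bar> \<le> norm (g' \<xi>' - g' \<beta>0) * norm e"
          by (rule Cauchy_Schwarz_ineq2)
        also have "\<dots> \<le> \<delta> / 2 * norm e"
          using \<epsilon>(2)[OF near'] by (intro mult_right_mono) (auto simp: dist_norm)
        finally show ?thesis
          by linarith
      qed
      ultimately have "\<delta> / 2 * norm e \<le> f \<xi> - f \<xi>'"
        using i(2) by linarith
      then have "\<tau> * (\<delta> / 2 * norm e) \<le> \<tau> * (f \<xi> - f \<xi>')"
        using \<tau>(1) by (intro mult_left_mono) auto
      moreover have "1/2 * (norm (\<beta> - \<xi>))\<^sup>2 + \<tau> * f \<xi> \<le> 1/2 * (norm (\<beta> - \<xi>'))\<^sup>2 + \<tau> * f \<xi>'"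
        unfolding \<xi>_def by (rule prox_minimal[OF cont sub])
      \<comment> \<open>Since \<open>a\<close> is orthogonal to \<open>e\<close>, the quadratic term
        sees only \<open>\<beta> - \<beta>0\<close> along \<open>e\<close>. Its gain is less than
        \<open>\<delta> / 2 * \<tau> * norm e\<close>, which the increase of the penalty
        outweighs.\<close>
      moreover have "(norm (\<beta> - \<xi>))\<^sup>2
          = (norm (\<beta> - \<xi>'))\<^sup>2 - 2 * ((\<beta> - \<beta>0) \<bullet> e) + (norm e)\<^sup>2"
      proof -
        have "\<beta> - \<xi> = (\<beta> - \<xi>') - e"
          by (simp add: \<xi>)
        moreover have "(\<beta> - \<xi>') \<bullet> e = (\<beta> - \<beta>0) \<bullet> e"
          using a[OF e] by (simp add: \<xi>'_def orthogonal_def inner_diff_left inner_add_left)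
        ultimately show ?thesis
          by (simp only: power2_norm_eq_inner)
            (simp add: inner_diff_left inner_diff_right inner_commute)
      qed
      moreover have "(\<beta> - \<beta>0) \<bullet> e < \<delta> / 2 * \<tau> * norm e"
        using norm_cauchy_schwarz[of "\<beta> - \<beta>0" e] \<beta> \<open>e \<noteq> 0\<close>
        by (meson mult_strict_right_mono order_le_less_trans zero_less_norm_iff)
      moreover have "\<tau> * (\<delta> / 2 * norm e) = \<delta> / 2 * \<tau> * norm e"
        by simp
      moreover have "\<tau> * (f \<xi> - f \<xi>') = \<tau> * f \<xi> - \<tau> * f \<xi>'"
        by (simp add: algebra_simps)
      ultimately show False
        using zero_le_power2[of "norm e"] by linarith
    qed
    then show ?thesis
      using pat \<xi> by (simp add: \<xi>_def)
  qed
  moreover have "\<eta> > 0"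
    using \<epsilon>(1) pos by (simp add: \<eta>_def)
  ultimately show ?thesis
    using \<delta>(1) by (intro that[of "\<delta> / 2" \<eta>]) auto
qed

section \<open>Weak limits and sub-gaussian tails\<close>

text \<open>A one-sided portmanteau estimate. The gap between the radii \<open>r / 2\<close> and
  \<open>r\<close> leaves room for a continuous cutoff between the two indicators.\<close>

lemma converges_in_distribution_liminf_ball:
  fixes Y :: "'b \<Rightarrow> 'e::euclidean_space"
  assumes M: "prob_space M" and X: "\<And>n. X n \<in> borel_measurable M"
    and N: "prob_space N" and Y: "Y \<in> borel_measurable N"
    and conv: "converges_in_distribution M X N Y" and r: "r > 0"
  shows "liminf (\<lambda>n. ereal (measure M {\<omega> \<in> space M. norm (X n \<omega>) < r}))
    \<ge> ereal (measure N {\<omega> \<in> space N. norm (Y \<omega>) \<le> r / 2})"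
proof -
  interpret M: prob_space M by fact
  interpret N: prob_space N by fact
  \<comment> \<open>Equal to 1 on the closed ball of radius \<open>r / 2\<close>, to 0 outside the
    open ball of radius \<open>r\<close>, and linear in the norm between them.\<close>
  define \<phi> :: "'e \<Rightarrow> real" where "\<phi> z = max 0 (min 1 (2 - 2 * norm z / r))" for z
  have \<phi>: "continuous_on UNIV \<phi>" "\<And>z. 0 \<le> \<phi> z" "\<And>z. \<phi> z \<le> 1"
    unfolding \<phi>_def using r by (auto intro!: continuous_intros)
  have [measurable]: "\<phi> \<in> borel_measurable borel"
    by (rule borel_measurable_continuous_onI[OF \<phi>(1)])
  note X[measurable] Y[measurable]
  have "bounded (range \<phi>)"
    unfolding bounded_iff using \<phi>(2,3) by (intro exI[of _ 1]) auto
  then have lim: "(\<lambda>n. \<integral>\<omega>. \<phi> (X n \<omega>) \<partial>M) \<longlonglongrightarrow> (\<integral>\<omega>. \<phi> (Y \<omega>) \<partial>N)"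
    using conv \<phi>(1) unfolding converges_in_distribution_def by blast
  have upper: "(\<integral>\<omega>. \<phi> (X n \<omega>) \<partial>M) \<le> measure M {\<omega> \<in> space M. norm (X n \<omega>) < r}" for n
  proof -
    have "(\<integral>\<omega>. \<phi> (X n \<omega>) \<partial>M)
        \<le> (\<integral>\<omega>. indicator {\<omega> \<in> space M. norm (X n \<omega>) < r} \<omega> \<partial>M)"
    proof (rule integral_mono)
      show "integrable M (\<lambda>\<omega>. \<phi> (X n \<omega>))"
        by (rule M.integrable_const_bound[where B = 1]) (use \<phi> in auto)
      show "integrable M (indicator {\<omega> \<in> space M. norm (X n \<omega>) < r} :: _ \<Rightarrow> real)"
        by (rule M.integrable_const_bound[where B = 1]) auto
      show "\<phi> (X n \<omega>) \<le> indicator {\<omega> \<in> space M. norm (X n \<omega>) < r} \<omega>" if "\<omega> \<in> space M" for \<omega>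
        using that r by (auto simp: \<phi>_def indicator_def field_simps)
    qed
    then show ?thesis
      by simp
  qed
  have lower: "measure N {\<omega> \<in> space N. norm (Y \<omega>) \<le> r / 2} \<le> (\<integral>\<omega>. \<phi> (Y \<omega>) \<partial>N)"
  proof -
    have "(\<integral>\<omega>. indicator {\<omega> \<in> space N. norm (Y \<omega>) \<le> r / 2} \<omega> \<partial>N) \<le> (\<integral>\<omega>. \<phi> (Y \<omega>) \<partial>N)"
    proof (rule integral_mono)
      show "integrable N (\<lambda>\<omega>. \<phi> (Y \<omega>))"
        by (rule N.integrable_const_bound[where B = 1]) (use \<phi> in auto)
      show "integrable N (indicator {\<omega> \<in> space N. norm (Y \<omega>) \<le> r / 2} :: _ \<Rightarrow> real)"
        by (rule N.integrable_const_bound[where B = 1]) auto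
      show "indicator {\<omega> \<in> space N. norm (Y \<omega>) \<le> r / 2} \<omega> \<le> \<phi> (Y \<omega>)" for \<omega>
        using r by (auto simp: \<phi>_def indicator_def field_simps)
    qed
    then show ?thesis
      by simp
  qed
  have "ereal (measure N {\<omega> \<in> space N. norm (Y \<omega>) \<le> r / 2}) \<le> ereal (\<integral>\<omega>. \<phi> (Y \<omega>) \<partial>N)"
    using lower by simp
  also have "\<dots> = liminf (\<lambda>n. ereal (\<integral>\<omega>. \<phi> (X n \<omega>) \<partial>M))"
    using lim by (intro lim_imp_Liminf[symmetric]) auto
  also have "\<dots> \<le> liminf (\<lambda>n. ereal (measure M {\<omega> \<in> space M. norm (X n \<omega>) < r}))"
    by (intro Liminf_mono always_eventually allI) (simp add: upper)
  finally show ?thesis .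
qed

text \<open>A union bound over the entries costs a factor \<open>m\<close>; since the tail is a probability, the
  factor can be absorbed into the exponent.\<close>

lemma min_one_exp_le:
  fixes x m :: real
  assumes "m \<ge> 1" "x \<ge> 0" "P \<le> 1" "P \<le> 2 * m * exp (- x)"
  shows "P \<le> 2 * exp (- (ln 2 / ln (2 * m) * x))"
proof -
  \<comment> \<open>With this exponent the target equals 1 exactly at \<open>x = ln (2 * m)\<close>.
    Below that point \<open>P \<le> 1\<close> suffices; above it the target decays no faster than
    the given bound because \<open>\<theta> \<le> 1\<close>.\<close>
  define \<theta> where "\<theta> = ln 2 / ln (2 * m)"
  have l: "ln (2 * m) \<ge> ln 2" "ln (2 * m) > 0"
    using assms(1) by auto
  have \<theta>: "0 < \<theta>" "\<theta> \<le> 1" "\<theta> * ln (2 * m) = ln 2"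
    using l by (auto simp: \<theta>_def)
  have two: "2 * exp (- (\<theta> * x)) = exp (ln 2 - \<theta> * x)"
    by (simp add: exp_diff exp_minus field_simps)
  have "P \<le> exp (ln 2 - \<theta> * x)"
  proof (cases "x \<le> ln (2 * m)")
    case True
    then have "\<theta> * x \<le> ln 2"
      using \<theta> by (metis mult_left_mono less_imp_le)
    then have "1 \<le> exp (ln 2 - \<theta> * x)"
      by simp
    with assms(3) show ?thesis
      by linarith
  next
    case False
    have "P \<le> exp (ln (2 * m) - x)"
      using assms(1,4) by (simp add: exp_diff exp_minus field_simps)
    also have "1 * (x - ln (2 * m)) \<ge> \<theta> * (x - ln (2 * m))"
      using False \<theta> by (intro mult_right_mono) auto
    then have "exp (ln (2 * m) - x) \<le> exp (ln 2 - \<theta> * x)"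
      using \<theta>(3) by (simp add: algebra_simps)
    finally show ?thesis .
  qed
  then show ?thesis
    using two by (simp add: \<theta>_def)
qed

text \<open>If the norm is at least \<open>t\<close>, so is the sum of the absolute entries, and
  some entry reaches \<open>t / m\<close>. A union bound over the \<open>m\<close> entries
  follows.\<close>

lemma sub_gaussian_norm:
  fixes W :: "'b \<Rightarrow> real ^ 'p"
  assumes N: "prob_space N" and W[measurable]: "W \<in> borel_measurable N"
    and sg: "\<And>k. sub_gaussian N (\<lambda>\<omega>. W \<omega> $ k)"
  shows "sub_gaussian N (\<lambda>\<omega>. norm (W \<omega>))"
proof -
  interpret N: prob_space N by fact
  define m where "m = real CARD('p)"
  have m: "m \<ge> 1"
    by (simp add: m_def Suc_leI)
  have "\<forall>k. \<exists>K>0. \<forall>t\<ge>0.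
      measure N {\<omega> \<in> space N. \<bar>W \<omega> $ k\<bar> \<ge> t} \<le> 2 * exp (- (t\<^sup>2) / K\<^sup>2)"
    using sg unfolding sub_gaussian_def by blast
  then obtain K where K: "\<And>k. K k > 0" "\<And>k t. t \<ge> 0 \<Longrightarrow>
      measure N {\<omega> \<in> space N. \<bar>W \<omega> $ k\<bar> \<ge> t} \<le> 2 * exp (- (t\<^sup>2) / (K k)\<^sup>2)"
    by metis
  have meas_k[measurable]: "(\<lambda>\<omega>. W \<omega> $ k) \<in> borel_measurable N" for k
    using sg by (simp add: sub_gaussian_def)
  \<comment> \<open>A common upper bound for the finitely many constants \<open>K k\<close>.\<close>
  define K0 where "K0 = (\<Sum>k\<in>UNIV. K k)"
  have K0: "K k \<le> K0" for k
    unfolding K0_def using K(1) by (intro member_le_sum) (auto intro: less_imp_le)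
  have K0_pos: "K0 > 0"
    using K0[of undefined] K(1)[of undefined] by linarith
  define \<theta> where "\<theta> = ln 2 / ln (2 * m)"
  have "\<theta> > 0"
    using m by (simp add: \<theta>_def)
  \<comment> \<open>In the new constant, \<open>m\<close> comes from the threshold
    \<open>t / m\<close> and \<open>sqrt \<theta>\<close> from absorbing the number of entries into
    the exponent.\<close>
  have "measure N {\<omega> \<in> space N. \<bar>norm (W \<omega>)\<bar> \<ge> t} \<le> 2 * exp (- (t\<^sup>2) / (m * K0 / sqrt \<theta>)\<^sup>2)"
    if t: "t \<ge> 0" for t
  proof -
    have "{\<omega> \<in> space N. \<bar>norm (W \<omega>)\<bar> \<ge> t} \<subseteq> (\<Union>k. {\<omega> \<in> space N. \<bar>W \<omega> $ k\<bar> \<ge> t / m})"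
    proof
      fix \<omega> assume \<omega>: "\<omega> \<in> {\<omega> \<in> space N. \<bar>norm (W \<omega>)\<bar> \<ge> t}"
      show "\<omega> \<in> (\<Union>k. {\<omega> \<in> space N. \<bar>W \<omega> $ k\<bar> \<ge> t / m})"
      proof (rule ccontr)
        assume "\<omega> \<notin> (\<Union>k. {\<omega> \<in> space N. \<bar>W \<omega> $ k\<bar> \<ge> t / m})"
        then have "\<bar>W \<omega> $ k\<bar> < t / m" for k
          using \<omega> by (auto simp: not_le)
        then have "(\<Sum>k\<in>UNIV. \<bar>W \<omega> $ k\<bar>) < (\<Sum>k\<in>(UNIV :: 'p set). t / m)"
          by (intro sum_strict_mono) auto
        also have "\<dots> = t"
          using m by (simp add: m_def)
        finally show False
          using norm_le_l1_cart[of "W \<omega>"] \<omega> by auto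
      qed
    qed
    then have "measure N {\<omega> \<in> space N. \<bar>norm (W \<omega>)\<bar> \<ge> t}
        \<le> measure N (\<Union>k. {\<omega> \<in> space N. \<bar>W \<omega> $ k\<bar> \<ge> t / m})"
      by (intro N.finite_measure_mono) auto
    also have "\<dots> \<le> (\<Sum>k\<in>UNIV. measure N {\<omega> \<in> space N. \<bar>W \<omega> $ k\<bar> \<ge> t / m})"
      by (intro N.finite_measure_subadditive_finite) auto
    also have "\<dots> \<le> (\<Sum>k\<in>(UNIV :: 'p set). 2 * exp (- (t\<^sup>2 / (m * K0)\<^sup>2)))"
    proof (rule sum_mono)
      fix k
      have "measure N {\<omega> \<in> space N. \<bar>W \<omega> $ k\<bar> \<ge> t / m} \<le> 2 * exp (- ((t / m)\<^sup>2) / (K k)\<^sup>2)"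
        using t m by (intro K(2)) auto
      also have "\<dots> = 2 * exp (- (t\<^sup>2 / (m * K k)\<^sup>2))"
        by (simp add: power_divide power_mult_distrib)
      also have "\<dots> \<le> 2 * exp (- (t\<^sup>2 / (m * K0)\<^sup>2))"
      proof -
        have "(m * K k)\<^sup>2 \<le> (m * K0)\<^sup>2"
          using K0[of k] K(1)[of k] m by (intro power_mono mult_left_mono) auto
        moreover have "(m * K k)\<^sup>2 > 0" "(m * K0)\<^sup>2 > 0"
          using K(1)[of k] K0_pos m by auto
        ultimately have "t\<^sup>2 / (m * K0)\<^sup>2 \<le> t\<^sup>2 / (m * K k)\<^sup>2"
          by (intro divide_left_mono) auto
        then show ?thesis
          by simp
      qed
      finally show "measure N {\<omega> \<in> space N. \<bar>W \<omega> $ k\<bar> \<ge> t / m}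
          \<le> 2 * exp (- (t\<^sup>2 / (m * K0)\<^sup>2))" .
    qed
    also have "\<dots> = 2 * m * exp (- (t\<^sup>2 / (m * K0)\<^sup>2))"
      by (simp add: m_def)
    finally have "measure N {\<omega> \<in> space N. \<bar>norm (W \<omega>)\<bar> \<ge> t}
        \<le> 2 * exp (- (\<theta> * (t\<^sup>2 / (m * K0)\<^sup>2)))"
      unfolding \<theta>_def using m by (intro min_one_exp_le) auto
    also have "\<theta> * (t\<^sup>2 / (m * K0)\<^sup>2) = t\<^sup>2 / (m * K0 / sqrt \<theta>)\<^sup>2"
      using \<open>\<theta> > 0\<close> by (simp add: power_divide)
    finally show ?thesis
      by simp
  qed
  moreover have "m * K0 / sqrt \<theta> > 0"
    using m K0_pos \<open>\<theta> > 0\<close> by simp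
  ultimately show ?thesis
    unfolding sub_gaussian_def by (intro conjI) (measurable, blast)
qed

section \<open>Pattern recovery\<close>

text \<open>The limit is rendered as a lower limit, so its existence is not presupposed;
  \<open>c\<close> is chosen uniformly in \<open>\<alpha>\<close>.\<close>

theorem theorem3p10:
  fixes S :: "'i set" and v :: "'i \<Rightarrow> real ^ 'p"
    and f g :: "real ^ 'p \<Rightarrow> real"
    and \<beta>0 :: "real ^ 'p"
    and M :: "'a measure" and \<beta>1 :: "nat \<Rightarrow> 'a \<Rightarrow> real ^ 'p"
    and N :: "'b measure" and W :: "'b \<Rightarrow> real ^ 'p"
  assumes "max_linear_form S v g f"
    and "prob_space M" and "\<And>n. \<beta>1 n \<in> borel_measurable M"
    and "prob_space N" and "W \<in> borel_measurable N"
    and "\<And>k. sub_gaussian N (\<lambda>\<omega>. W \<omega> $ k)"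
    and "converges_in_distribution M (\<lambda>n \<omega>. sqrt (real n) *\<^sub>R (\<beta>1 n \<omega> - \<beta>0)) N W"
    and "pattern_space S v \<beta>0 \<inter> rel_interior (subdifferential f \<beta>0) \<noteq> {}"
  shows "\<exists>c>0. \<forall>\<alpha>\<ge>0.
    liminf (\<lambda>n. ereal (measure M {\<omega> \<in> space M.
        pattern S v (prox (\<lambda>x. real n powr (-1/2) * \<alpha> * f x) (\<beta>1 n \<omega>)) = pattern S v \<beta>0}))
      \<ge> ereal (1 - 2 * exp (- c * \<alpha>\<^sup>2))"
proof -
  note f = assms(1)
  interpret M: prob_space M by fact
  interpret N: prob_space N by fact
  note [measurable] = assms(3,5)
  obtain \<delta> \<eta> where \<delta>: "\<delta> > 0" and \<eta>: "\<eta> > 0"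
    and recovery: "\<And>\<tau> \<beta>. 0 < \<tau> \<Longrightarrow> \<tau> < \<eta> \<Longrightarrow> norm (\<beta> - \<beta>0) < \<delta> * \<tau> \<Longrightarrow>
      pattern S v (prox (\<lambda>x. \<tau> * f x) \<beta>) = pattern S v \<beta>0"
    using prox_pattern_recovery[OF assms(1,8)] by metis
  obtain K where K: "K > 0" "\<And>t. t \<ge> 0 \<Longrightarrow>
      measure N {\<omega> \<in> space N. \<bar>norm (W \<omega>)\<bar> \<ge> t} \<le> 2 * exp (- (t\<^sup>2) / K\<^sup>2)"
    using sub_gaussian_norm[OF assms(4-6)] unfolding sub_gaussian_def by metis
  \<comment> \<open>The tail of \<open>norm W\<close> will be evaluated at
    \<open>\<delta> * \<alpha> / 2\<close>, where its exponent is
    \<open>- c * \<alpha>\<^sup>2\<close>.\<close>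
  define c where "c = (\<delta> / (2 * K))\<^sup>2"
  let ?Z = "\<lambda>n \<omega>. sqrt (real n) *\<^sub>R (\<beta>1 n \<omega> - \<beta>0)"
  let ?E = "\<lambda>\<alpha> n. {\<omega> \<in> space M.
      pattern S v (prox (\<lambda>x. real n powr (-1/2) * \<alpha> * f x) (\<beta>1 n \<omega>)) = pattern S v \<beta>0}"
  obtain s where s: "s \<in> subdifferential f \<beta>0"
    using assms(8) rel_interior_subset by blast
  \<comment> \<open>Monotonicity of \<open>measure\<close> below requires the larger set to be
    measurable, as non-measurable sets have measure 0 by convention.\<close>
  have meas: "?E \<alpha> n \<in> sets M" if "\<alpha> \<ge> 0" for \<alpha> n
  proof -
    let ?h = "\<lambda>x. real n powr (-1/2) * \<alpha> * f x"
    have l: "real n powr (-1/2) * \<alpha> \<ge> 0"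
      using that by simp
    have "continuous_on UNIV (prox ?h)"
      by (rule continuous_on_prox[OF convex_on_cmul[OF l max_linear_form_convex[OF f]]
            subdifferential_cmult[OF s l]])
    then have "prox ?h \<in> borel_measurable borel"
      by (rule borel_measurable_continuous_onI)
    then have "(\<lambda>\<omega>. prox ?h (\<beta>1 n \<omega>)) \<in> borel_measurable M"
      by (rule measurable_compose[OF assms(3)])
    moreover have "{x. pattern S v x = pattern S v \<beta>0} \<in> sets borel"
      using f by (intro pattern_measurable) (simp add: max_linear_form_def)
    ultimately have "(\<lambda>\<omega>. prox ?h (\<beta>1 n \<omega>)) -` {x. pattern S v x = pattern S v \<beta>0} \<inter> space M
        \<in> sets M"
      by (rule measurable_sets)
    moreover have "(\<lambda>\<omega>. prox ?h (\<beta>1 n \<omega>)) -` {x. pattern S v x = pattern S v \<beta>0} \<inter> space M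
        = ?E \<alpha> n"
      by auto
    ultimately show ?thesis
      by simp
  qed
  have "liminf (\<lambda>n. ereal (measure M (?E \<alpha> n))) \<ge> ereal (1 - 2 * exp (- c * \<alpha>\<^sup>2))"
    if \<alpha>: "\<alpha> \<ge> 0" for \<alpha>
  proof (cases "\<alpha> = 0")
    case True
    \<comment> \<open>For \<open>\<alpha> = 0\<close> the recovery result does not apply, but the
      claimed bound is then -1.\<close>
    have "ereal (-1) \<le> liminf (\<lambda>n. ereal (measure M (?E \<alpha> n)))"
    proof (rule Liminf_bounded, intro always_eventually allI)
      show "ereal (-1) \<le> ereal (measure M (?E \<alpha> n))" for n
        using measure_nonneg[of M "?E \<alpha> n"] by (simp del: measure_nonneg)
    qed
    then show ?thesis
      using True by simp
  next
    case False
    with \<alpha> have pos: "\<alpha> > 0"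
      by simp
    define r where "r = \<delta> * \<alpha>"
    have r: "r > 0"
      using \<delta> pos by (simp add: r_def)
    have "(\<lambda>n. real n powr (-1/2)) \<longlonglongrightarrow> 0"
      by (rule tendsto_neg_powr[OF _ filterlim_real_sequentially]) simp
    then have "(\<lambda>n. real n powr (-1/2) * \<alpha>) \<longlonglongrightarrow> 0 * \<alpha>"
      by (intro tendsto_intros)
    then have "\<forall>\<^sub>F n in sequentially. real n powr (-1/2) * \<alpha> < \<eta>"
      using \<eta> by (intro order_tendstoD) auto
    then have "\<forall>\<^sub>F n in sequentially.
        measure M {\<omega> \<in> space M. norm (?Z n \<omega>) < r} \<le> measure M (?E \<alpha> n)"
      \<comment> \<open>This discards \<open>n = 0\<close>, where \<open>real n powr (-1/2)\<close>
        is 0 by convention.\<close>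
      using eventually_gt_at_top[of 0]
    proof eventually_elim
      case (elim n)
      let ?l = "real n powr (-1/2) * \<alpha>"
      have sq: "real n powr (-1/2) = 1 / sqrt (real n)"
        using powr_minus_divide[of "real n" "1/2"] by (simp add: powr_half_sqrt)
      show ?case
      proof (rule M.finite_measure_mono[OF _ meas[OF \<alpha>]], rule subsetI)
        fix \<omega> assume \<omega>: "\<omega> \<in> {\<omega> \<in> space M. norm (?Z n \<omega>) < r}"
        \<comment> \<open>Dividing by \<open>sqrt (real n)\<close> turns the fixed radius
          \<open>\<delta> * \<alpha>\<close> into the shrinking radius \<open>\<delta> * ?l\<close>
          required for recovery.\<close>
        then have "norm (\<beta>1 n \<omega> - \<beta>0) < \<delta> * ?l"
          using elim(2) unfolding sq by (simp add: r_def pos_less_divide_eq mult_ac)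
        then have "pattern S v (prox (\<lambda>x. ?l * f x) (\<beta>1 n \<omega>)) = pattern S v \<beta>0"
          using elim pos by (intro recovery) auto
        with \<omega> show "\<omega> \<in> ?E \<alpha> n"
          by simp
      qed
    qed
    then have le: "liminf (\<lambda>n. ereal (measure M {\<omega> \<in> space M. norm (?Z n \<omega>) < r}))
        \<le> liminf (\<lambda>n. ereal (measure M (?E \<alpha> n)))"
      by (intro Liminf_mono) simp
    have "1 - 2 * exp (- c * \<alpha>\<^sup>2) \<le> measure N {\<omega> \<in> space N. norm (W \<omega>) \<le> r / 2}"
    proof -
      have "1 = measure N (space N)"
        by (simp add: N.prob_space)
      also have "\<dots> \<le> measure N ({\<omega> \<in> space N. norm (W \<omega>) \<le> r / 2}
          \<union> {\<omega> \<in> space N. \<bar>norm (W \<omega>)\<bar> \<ge> r / 2})"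
        by (intro N.finite_measure_mono) auto
      also have "\<dots> \<le> measure N {\<omega> \<in> space N. norm (W \<omega>) \<le> r / 2}
          + measure N {\<omega> \<in> space N. \<bar>norm (W \<omega>)\<bar> \<ge> r / 2}"
        by (intro measure_Un_le) auto
      also have "measure N {\<omega> \<in> space N. \<bar>norm (W \<omega>)\<bar> \<ge> r / 2}
          \<le> 2 * exp (- ((r / 2)\<^sup>2) / K\<^sup>2)"
        using r by (intro K(2)) auto
      also have "- ((r / 2)\<^sup>2) / K\<^sup>2 = - c * \<alpha>\<^sup>2"
        by (simp add: r_def c_def power_divide power_mult_distrib)
      finally show ?thesis
        by simp
    qed
    then have "ereal (1 - 2 * exp (- c * \<alpha>\<^sup>2))
        \<le> ereal (measure N {\<omega> \<in> space N. norm (W \<omega>) \<le> r / 2})"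
      by simp
    also have "\<dots> \<le> liminf (\<lambda>n. ereal (measure M {\<omega> \<in> space M. norm (?Z n \<omega>) < r}))"
      by (rule converges_in_distribution_liminf_ball[OF assms(2) _ assms(4,5,7) r]) measurable
    also note le
    finally show ?thesis .
  qed
  moreover have "c > 0"
    using \<delta> K(1) by (simp add: c_def)
  ultimately show ?thesis
    by blast
qed

end
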